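(* There exist SBP operators that do not satisfy the eigenvalue assumption. That is, there exist an SBP operator $(D, M, t_L, t_R)$ of some order $p \ge 1$ on some interval $[0,T]$, $T>0$, and a number $\sigma > \frac12$ such that the matrix $D + \sigma M^{-1} t_L t_L^T$ has an eigenvalue $\lambda \in \mathbb{C}$ whose real part is not strictly positive.
   Context: Let $T>0$ and let $0 \le \tau_1 < \dots < \tau_s \le T$ be a grid of $s$ nodes. A function $u$ on $[0,T]$ is represented by the vector of nodal values $(u(\tau_1),\dots,u(\tau_s))^T \in \mathbb{R}^s$. An SBP (summation by parts) operator of order $p \in \mathbb{N}$, $p\ge 1$, on $[0,T]$ with these nodes consists of: a matrix $D \in \mathbb{R}^{s\times s}$ approximating the derivative with order of accuracy $p$ (i.e. $D$ maps the nodal values of every polynomial of degree $\le p$ to the nodal values of its derivative); a symmetric positive definite matrix $M \in \mathbb{R}^{s\times s}$ (mass/norm matrix, whose bilinear form $u^T M v$ is interpreted as an approximation of $\int_0^T u(t)v(t)\,dt$); and vectors $t_L, t_R \in \mathbb{R}^s$ approximating interpolation to the boundary, $t_L^T u \approx u(0)$ and $t_R^T u \approx u(T)$, with order of accuracy at least $p$ (i.e. exactly for nodal values of polynomials of degree $\le p$); such that $$M D + D^T M = t_R t_R^T - t_L t_L^T .$$ Eigenvalue assumption for an SBP operator: for every $\sigma > \frac12$, all (complex) eigenvalues of $D + \sigma M^{-1} t_L t_L^T$ have strictly positive real part. *)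

theory Defs
  imports "Jordan_Normal_Form.Char_Poly" "Jordan_Normal_Form.Gauss_Jordan_Elimination"
    Complex_Main
begin

definition nodal :: "real vec \<Rightarrow> real poly \<Rightarrow> real vec" where
  "nodal \<tau> q = map_vec (poly q) \<tau>"

definition outer_prod :: "real vec \<Rightarrow> real vec \<Rightarrow> real mat" where
  "outer_prod u v = mat (dim_vec u) (dim_vec v) (\<lambda>(i, j). u $ i * v $ j)"

definition spd_mat :: "nat \<Rightarrow> real mat \<Rightarrow> bool" where
  "spd_mat n M \<longleftrightarrow> M \<in> carrier_mat n n \<and> transpose_mat M = M \<and>
     (\<forall>u \<in> carrier_vec n. u \<noteq> 0\<^sub>v n \<longrightarrow> 0 < u \<bullet> (M *\<^sub>v u))"

definition grid :: "real \<Rightarrow> nat \<Rightarrow> real vec \<Rightarrow> bool" where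
  "grid T s \<tau> \<longleftrightarrow> \<tau> \<in> carrier_vec s \<and> (\<forall>i < s. 0 \<le> \<tau> $ i \<and> \<tau> $ i \<le> T) \<and>
     (\<forall>i j. i < j \<longrightarrow> j < s \<longrightarrow> \<tau> $ i < \<tau> $ j)"

text \<open>The case \<open>s = 0\<close> is excluded by the exactness of \<open>t\<^sub>L\<close> on constants.\<close>

definition sbp_operator ::
  "nat \<Rightarrow> real \<Rightarrow> nat \<Rightarrow> real vec \<Rightarrow> real mat \<Rightarrow> real mat \<Rightarrow> real vec \<Rightarrow> real vec \<Rightarrow> bool" where
  "sbp_operator p T s \<tau> D M t\<^sub>L t\<^sub>R \<longleftrightarrow>
     1 \<le> p \<and> 0 < T \<and> grid T s \<tau> \<and>
     D \<in> carrier_mat s s \<and> spd_mat s M \<and> t\<^sub>L \<in> carrier_vec s \<and> t\<^sub>R \<in> carrier_vec s \<and>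
     (\<forall>q. degree q \<le> p \<longrightarrow> D *\<^sub>v nodal \<tau> q = nodal \<tau> (pderiv q)) \<and>
     (\<forall>q. degree q \<le> p \<longrightarrow> t\<^sub>L \<bullet> nodal \<tau> q = poly q 0) \<and>
     (\<forall>q. degree q \<le> p \<longrightarrow> t\<^sub>R \<bullet> nodal \<tau> q = poly q T) \<and>
     M * D + transpose_mat D * M = outer_prod t\<^sub>R t\<^sub>R - outer_prod t\<^sub>L t\<^sub>L"

text \<open>The library function \<^const>\<open>mat_inverse\<close> returns an option; for a symmetric positive
  definite matrix its value is \<^const>\<open>Some\<close> of the inverse.\<close>

lemma spd_mat_inverse:
  assumes "spd_mat n M"
  shows "the (mat_inverse M) \<in> carrier_mat n n"
    and "M * the (mat_inverse M) = 1\<^sub>m n" and "the (mat_inverse M) * M = 1\<^sub>m n"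
proof -
  have M: "M \<in> carrier_mat n n" using assms by (simp add: spd_mat_def)
  have "det M \<noteq> 0"
  proof
    assume "det M = 0"
    then obtain v where v: "v \<in> carrier_vec n" "v \<noteq> 0\<^sub>v n" "M *\<^sub>v v = 0\<^sub>v n"
      using det_0_iff_vec_prod_zero[OF M] by auto
    then have "0 < v \<bullet> (M *\<^sub>v v)" using assms unfolding spd_mat_def by blast
    with v show False by simp
  qed
  then have "M \<in> Units (ring_mat TYPE(real) n ())"
    using M by (simp add: det_non_zero_imp_unit)
  then obtain N where N: "mat_inverse M = Some N"
    using mat_inverse(1)[OF M, where b = "()"] by (cases "mat_inverse M") auto
  from mat_inverse(2)[OF M N] N
  show "the (mat_inverse M) \<in> carrier_mat n n"
    and "M * the (mat_inverse M) = 1\<^sub>m n" and "the (mat_inverse M) * M = 1\<^sub>m n"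
    by auto
qed

definition sat_mat :: "real mat \<Rightarrow> real mat \<Rightarrow> real vec \<Rightarrow> real \<Rightarrow> real mat" where
  "sat_mat D M t\<^sub>L \<sigma> = D + \<sigma> \<cdot>\<^sub>m (the (mat_inverse M) * outer_prod t\<^sub>L t\<^sub>L)"

definition eigenvalue_assumption :: "real mat \<Rightarrow> real mat \<Rightarrow> real vec \<Rightarrow> bool" where
  "eigenvalue_assumption D M t\<^sub>L \<longleftrightarrow>
     (\<forall>\<sigma> > 1/2. \<forall>\<mu> :: complex.
        eigenvalue (map_mat complex_of_real (sat_mat D M t\<^sub>L \<sigma>)) \<mu> \<longrightarrow> 0 < Re \<mu>)"

end

theory Submission
  imports Defs
begin

text \<open>
  Multiplying \<open>A = D + \<sigma> M\<^sup>-\<^sup>1 t\<^sub>L t\<^sub>L\<^sup>T\<close> by \<open>M\<close> and symmetrizing turns the SBP identity into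
  \<open>M A + A\<^sup>T M = t\<^sub>R t\<^sub>R\<^sup>T + (2\<sigma> - 1) t\<^sub>L t\<^sub>L\<^sup>T\<close>, which is positive semidefinite for \<open>\<sigma> > 1/2\<close>.
  Hence eigenvalues of \<open>A\<close> never have negative real part, and an imaginary eigenvalue can only come
  from an eigenvector \<open>v\<close> of \<open>D\<close> that neither \<open>t\<^sub>L\<close> nor \<open>t\<^sub>R\<close> sees. So a counterexample
  has to contain such an invisible mode, and the simplest choice is one with \<open>D v = 0\<close>: then
  \<open>A v = 0\<close> for every \<open>\<sigma>\<close> (lemma \<open>kernel_vec_violates_eigenvalue_assumption\<close>).

  For order 1 three nodes suffice, because \<open>1, x, v\<close> is then a basis of the nodal values and the
  operators may be prescribed on it: \<open>D\<close> is forced to map \<open>1, x, v\<close> to \<open>0, 1, 0\<close>, and \<open>t\<^sub>L\<close>,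
  \<open>t\<^sub>R\<close> to be the boundary values on \<open>1, x\<close> and zero on \<open>v\<close>. In this basis the SBP identity
  reduces to \<open>M(1,1) = T\<close>, \<open>M(1,x) = T\<^sup>2/2\<close> and \<open>M(1,v) = 0\<close>; that is, \<open>M\<close> has to integrate
  \<open>1\<close> and \<open>x\<close> exactly and to make \<open>v\<close> orthogonal to the constants.
  On the nodes \<open>0, 1, 2\<close> the trapezoidal weights \<open>1/2, 1, 1/2\<close> and the sawtooth
  \<open>v = (1, -1, 1)\<close> meet these conditions. The resulting \<open>D\<close> assigns to every node the central
  difference over \<open>[0,2]\<close>, and \<open>t\<^sub>L = (3/4, 1/2, -1/4)\<close>, \<open>t\<^sub>R = (-1/4, 1/2, 3/4)\<close>.
\<close>

lemma outer_prod_mult_vec: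
  assumes "dim_vec w = dim_vec v"
  shows "outer_prod u v *\<^sub>v w = (v \<bullet> w) \<cdot>\<^sub>v u"
  using assms
  by (intro eq_vecI)
    (auto simp: outer_prod_def scalar_prod_def sum_distrib_left mult_ac)

lemma smult_1_mat: "(1 :: 'a :: semiring_1) \<cdot>\<^sub>m A = A"
  by (rule eq_matI) auto

text \<open>
  The boundary term \<open>\<sigma> M\<^sup>-\<^sup>1 t\<^sub>L t\<^sub>L\<^sup>T\<close> acts on a vector only through its product with \<open>t\<^sub>L\<close>, so a
  kernel vector of \<open>D\<close> annihilated by \<open>t\<^sub>L\<close> keeps the eigenvalue 0 whatever \<open>\<sigma>\<close> is.
\<close>

lemma kernel_vec_violates_eigenvalue_assumption:
  assumes D: "D \<in> carrier_mat n n" and M: "spd_mat n M"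
    and t: "t \<in> carrier_vec n" and v: "v \<in> carrier_vec n" "v \<noteq> 0\<^sub>v n"
    and Dv: "D *\<^sub>v v = 0\<^sub>v n" and tv: "t \<bullet> v = 0"
  shows "\<not> eigenvalue_assumption D M t"
proof -
  \<comment> \<open>Any \<open>\<sigma> > 1/2\<close> would do, since \<open>\<sigma>\<close> only scales a term that vanishes on \<open>v\<close>.\<close>
  define A where "A = sat_mat D M t 1"
  let ?N = "the (mat_inverse M)"
  have N: "?N \<in> carrier_mat n n" using spd_mat_inverse(1)[OF M] .
  have O: "outer_prod t t \<in> carrier_mat n n" using t by (simp add: outer_prod_def)
  have Ov: "outer_prod t t *\<^sub>v v = 0\<^sub>v n"
    using t v tv by (subst outer_prod_mult_vec) (auto intro!: eq_vecI)
  have A: "A \<in> carrier_mat n n"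
    using D N O by (simp add: A_def sat_mat_def)
  have "A *\<^sub>v v = D *\<^sub>v v + (?N * outer_prod t t) *\<^sub>v v"
    unfolding A_def sat_mat_def using D N O v
    by (simp add: smult_1_mat add_mult_distrib_mat_vec[of _ n n])
  also have "(?N * outer_prod t t) *\<^sub>v v = ?N *\<^sub>v (outer_prod t t *\<^sub>v v)"
    using assoc_mult_mat_vec[OF N O v(1)] .
  also have "\<dots> = 0\<^sub>v n"
    using N by (auto simp: Ov)
  finally have "A *\<^sub>v v = 0\<^sub>v n"
    using Dv by auto
  then have "eigenvector A v 0"
    using A v by (auto simp: eigenvector_def)
  then have "eigenvalue A 0"
    unfolding eigenvalue_def by blast
  then have "poly (char_poly A) 0 = 0"
    using eigenvalue_root_char_poly[OF A] by simp
  \<comment> \<open>The eigenvalue is passed from the real to the complex matrix as a root of the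
    characteristic polynomial, whose coefficients are real.\<close>
  moreover have "poly (char_poly (map_mat complex_of_real A)) (of_real 0)
      = of_real (poly (char_poly A) 0)"
    by (simp only: of_real_hom.char_poly_hom[OF A] of_real_hom.poly_map_poly)
  ultimately have "poly (char_poly (map_mat complex_of_real A)) 0 = 0"
    by simp
  then have "eigenvalue (map_mat complex_of_real A) 0"
    using eigenvalue_root_char_poly[of "map_mat complex_of_real A" n 0] A by simp
  then show ?thesis
    unfolding eigenvalue_assumption_def A_def not_all by (intro exI[of _ 1]) auto
qed

definition trapezoidal_mass :: "real mat" where
  "trapezoidal_mass = mat_of_rows_list 3 [[1/2, 0, 0], [0, 1, 0], [0, 0, 1/2]]"

definition central_diff :: "real mat" where
  "central_diff = mat_of_rows_list 3 [[-1/2, 0, 1/2], [-1/2, 0, 1/2], [-1/2, 0, 1/2]]"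

definition left_interp :: "real vec" where
  "left_interp = vec_of_list [3/4, 1/2, -1/4]"

definition right_interp :: "real vec" where
  "right_interp = vec_of_list [-1/4, 1/2, 3/4]"

definition sawtooth :: "real vec" where
  "sawtooth = vec_of_list [1, -1, 1]"

lemma less_3_cases: "i < 3 \<longleftrightarrow> i = 0 \<or> i = 1 \<or> i = (2::nat)"
  by auto

lemma atLeastLessThan_0_3: "{0..<3} = {0, 1, 2::nat}"
  by auto

lemma mat_of_rows_list_3:
  "mat_of_rows_list 3 [a, b, c] = mat 3 3 (\<lambda>(i, j). [a, b, c] ! i ! j)"
  by (simp add: mat_of_rows_list_def numeral_3_eq_3)

lemma vCons_3: "vCons a (vCons b (vCons c vNil)) = vec 3 (\<lambda>i. [a, b, c] ! i)"
  by (intro eq_vecI) (auto simp: less_3_cases vec_index_vCons numeral_3_eq_3)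

lemma spd_trapezoidal_mass: "spd_mat 3 trapezoidal_mass"
  unfolding spd_mat_def
proof (intro conjI ballI impI)
  show "trapezoidal_mass \<in> carrier_mat 3 3"
    by (simp add: trapezoidal_mass_def mat_of_rows_list_3)
  show "transpose_mat trapezoidal_mass = trapezoidal_mass"
    by (rule eq_matI) (auto simp: trapezoidal_mass_def mat_of_rows_list_3 less_3_cases)
next
  fix u :: "real vec" assume u: "u \<in> carrier_vec 3" "u \<noteq> 0\<^sub>v 3"
  have "u \<bullet> (trapezoidal_mass *\<^sub>v u) = (u $ 0)\<^sup>2 / 2 + (u $ 1)\<^sup>2 + (u $ 2)\<^sup>2 / 2"
    using u by (simp add: trapezoidal_mass_def mat_of_rows_list_3 scalar_prod_def
        atLeastLessThan_0_3 power2_eq_square)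
  moreover have "u $ 0 \<noteq> 0 \<or> u $ 1 \<noteq> 0 \<or> u $ 2 \<noteq> 0"
    using u by (auto simp: less_3_cases intro!: eq_vecI)
  then have "0 < (u $ 0)\<^sup>2 / 2 + (u $ 1)\<^sup>2 + (u $ 2)\<^sup>2 / 2"
    by (auto simp: add_pos_nonneg add_nonneg_pos)
  ultimately show "0 < u \<bullet> (trapezoidal_mass *\<^sub>v u)" by simp
qed

lemma degree_le_1_cases:
  assumes "degree q \<le> 1"
  obtains a b where "q = [:a, b:]"
proof
  show "q = [:coeff q 0, coeff q 1:]"
    using assms by (intro poly_eqI) (auto simp: coeff_pCons coeff_eq_0 split: nat.split)
qed

lemma sbp_operator_trapezoidal:
  "sbp_operator 1 2 3 (vec_of_list [0, 1, 2])
     central_diff trapezoidal_mass left_interp right_interp"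
  unfolding sbp_operator_def
proof (intro conjI allI impI)
  show "grid 2 3 (vec_of_list [0, 1, 2])"
    by (auto simp: grid_def less_3_cases less_2_cases_iff vCons_3)
  show "spd_mat 3 trapezoidal_mass" by (rule spd_trapezoidal_mass)
  show "central_diff \<in> carrier_mat 3 3"
    by (simp add: central_diff_def mat_of_rows_list_3)
  show "left_interp \<in> carrier_vec 3" "right_interp \<in> carrier_vec 3"
    by (simp_all add: left_interp_def right_interp_def vCons_3)
  show "trapezoidal_mass * central_diff + transpose_mat central_diff * trapezoidal_mass
      = outer_prod right_interp right_interp - outer_prod left_interp left_interp"
    by (rule eq_matI)
      (auto simp: trapezoidal_mass_def central_diff_def left_interp_def right_interp_def
        outer_prod_def mat_of_rows_list_3 scalar_prod_def less_3_cases vCons_3 atLeastLessThan_0_3)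
next
  fix q :: "real poly" assume "degree q \<le> 1"
  then obtain a b where q: "q = [:a, b:]" by (rule degree_le_1_cases)
  show "central_diff *\<^sub>v nodal (vec_of_list [0, 1, 2]) q
      = nodal (vec_of_list [0, 1, 2]) (pderiv q)"
    by (rule eq_vecI)
      (auto simp: q central_diff_def nodal_def mat_of_rows_list_3 scalar_prod_def
        less_3_cases vCons_3 atLeastLessThan_0_3 pderiv_pCons field_simps)
  show "left_interp \<bullet> nodal (vec_of_list [0, 1, 2]) q = poly q 0"
    "right_interp \<bullet> nodal (vec_of_list [0, 1, 2]) q = poly q 2"
    by (simp_all add: q left_interp_def right_interp_def nodal_def scalar_prod_def
        vCons_3 atLeastLessThan_0_3 field_simps)
qed simp_all

theorem theorem2p1:
  shows "\<exists>p T s \<tau> D M t\<^sub>L t\<^sub>R.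
    sbp_operator p T s \<tau> D M t\<^sub>L t\<^sub>R \<and> \<not> eigenvalue_assumption D M t\<^sub>L"
proof -
  have "\<not> eigenvalue_assumption central_diff trapezoidal_mass left_interp"
  proof (rule kernel_vec_violates_eigenvalue_assumption)
    show "central_diff \<in> carrier_mat 3 3" "spd_mat 3 trapezoidal_mass"
      "left_interp \<in> carrier_vec 3"
      using sbp_operator_trapezoidal by (simp_all add: sbp_operator_def)
    show "sawtooth \<in> carrier_vec 3"
      by (simp add: sawtooth_def vCons_3)
    have "sawtooth $ 0 \<noteq> 0\<^sub>v 3 $ 0"
      by (simp add: sawtooth_def vCons_3)
    then show "sawtooth \<noteq> 0\<^sub>v 3" by metis
    show "central_diff *\<^sub>v sawtooth = 0\<^sub>v 3"
      by (rule eq_vecI)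
        (auto simp: central_diff_def sawtooth_def mat_of_rows_list_3 scalar_prod_def
          less_3_cases vCons_3 atLeastLessThan_0_3)
    show "left_interp \<bullet> sawtooth = 0"
      by (simp add: left_interp_def sawtooth_def scalar_prod_def vCons_3 atLeastLessThan_0_3)
  qed
  with sbp_operator_trapezoidal show ?thesis by blast
qed

end
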